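(* There exist infinitely many permutations of $\mathbb{N}$ (bijections $\mathbb{N}\to\mathbb{N}$) which are pairwise divergent: for any two distinct ones $x=(x_1,x_2,\dots)$ and $y=(y_1,y_2,\dots)$, $|x_n-y_n|\to\infty$ as $n\to\infty$.
   Context: An infinite permutation is a bijection $x:\mathbb{N}\to\mathbb{N}$, written as the sequence $(x_1,x_2,\dots)$ with $x_n$ the entry in position $n$. Two infinite permutations $x,y$ diverge if $\lim_{n\to\infty}|x_n-y_n|=\infty$. *)

theory Defs
  imports Complex_Main "HOL-Combinatorics.Permutations"
begin

text \<open>
  Sequences are indexed from 1 and have positive entries.  The value at the
  unused index 0 is fixed to 0 (by \<open>permutes\<close>), so that equality of functions
  is exactly equality of the sequences.
\<close>

definition infinite_permutation :: "(nat \<Rightarrow> nat) \<Rightarrow> bool" where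
  "infinite_permutation x \<longleftrightarrow> x permutes {1..}"

definition diverge :: "(nat \<Rightarrow> nat) \<Rightarrow> (nat \<Rightarrow> nat) \<Rightarrow> bool" where
  "diverge x y \<longleftrightarrow> filterlim (\<lambda>n. \<bar>int (x n) - int (y n)\<bar>) at_top sequentially"

lemma infinite_permutation_iff_bij_betw:
  "infinite_permutation x \<longleftrightarrow> bij_betw x {1..} {1..} \<and> x 0 = 0"
  unfolding infinite_permutation_def
proof
  assume "x permutes {1..}"
  then show "bij_betw x {1..} {1..} \<and> x 0 = 0"
    by (auto intro: permutes_imp_bij permutes_not_in)
next
  assume "bij_betw x {1..} {1..} \<and> x 0 = 0"
  then show "x permutes {1..}"
    by (intro bij_imp_permutes) (auto simp: not_less_eq_eq)
qed

end

theory Submission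
  imports Defs "HOL-Library.Discrete_Functions"
begin

text \<open>
  Split the positive integers into the dyadic blocks \<open>[2^m, 2^(m+1))\<close> and put \<open>t = m div 2\<close>.
  On every block with \<open>k < 2^t\<close>, the \<open>k\<close>-th permutation XORs \<open>n\<close> with \<open>k * 2^t\<close>; this is an
  involution of the block, as \<open>k * 2^t < 2^m\<close>.  For \<open>j \<noteq> k\<close> the images of \<open>n\<close> are distinct but
  congruent modulo \<open>2^t\<close>, so they are at least \<open>2^t\<close> apart.
\<close>

unbundle bit_operations_syntax

definition half_log :: "nat \<Rightarrow> nat" where
  "half_log n = floor_log n div 2"

text \<open>The guard keeps the mask \<open>push_bit (half_log n) k\<close> below the leading bit of
  a positive \<open>n\<close>. For each \<open>k\<close> it fails for only finitely many
  \<open>n\<close>, so the default value \<open>n\<close> does not affect divergence.\<close>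

definition xor_perm :: "nat \<Rightarrow> nat \<Rightarrow> nat" where
  "xor_perm k n = (if k < 2 ^ half_log n then n XOR push_bit (half_log n) k else n)"

text \<open>For positive \<open>n\<close>, all bits of \<open>c\<close> lie below the leading bit of
  \<open>n\<close>, so XOR keeps that bit and sets none above it.\<close>

lemma floor_log_xor:
  fixes n c :: nat
  assumes "c < 2 ^ floor_log n"
  shows "floor_log (n XOR c) = floor_log n"
proof (cases "n = 0")
  case True
  with assms show ?thesis by simp
next
  case False
  define m where "m = floor_log n"
  have "2 ^ m \<le> n" "n < 2 * 2 ^ m"
    using False floor_log_exp2_le[of n] floor_log_exp2_gt[of n] by (auto simp: m_def)
  then have "drop_bit m n = 1"
    unfolding drop_bit_eq_div by (intro div_nat_eqI) auto
  moreover have "drop_bit m c = 0"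
    using assms by (simp add: drop_bit_eq_div m_def)
  ultimately have "(n XOR c) div 2 ^ m = 1"
    by (simp flip: drop_bit_eq_div)
  then have "2 ^ m \<le> n XOR c" "n XOR c < 2 * 2 ^ m"
    using div_times_less_eq_dividend[of "n XOR c" "2 ^ m"]
      dividend_less_div_times[of "2 ^ m" "n XOR c"] by auto
  then show ?thesis
    by (intro floor_log_eqI) (auto simp: m_def)
qed

text \<open>Since \<open>2 * (m div 2) \<le> m\<close>, the mask stays below \<open>2 ^ m\<close>.
  Hence a second application of \<open>xor_perm k\<close> meets the same guard and mask, and the two
  XORs cancel.\<close>

lemma half_log_xor_perm: "half_log (xor_perm k n) = half_log n"
proof (cases "k < 2 ^ half_log n")
  case True
  then have "push_bit (half_log n) k < 2 ^ half_log n * 2 ^ half_log n"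
    by (simp add: push_bit_eq_mult)
  also have "\<dots> = 2 ^ (2 * half_log n)"
    by (simp add: mult_2 power_add)
  also have "\<dots> \<le> 2 ^ floor_log n"
    by (intro power_increasing) (auto simp: half_log_def)
  finally show ?thesis
    using True floor_log_xor by (simp add: xor_perm_def half_log_def)
qed (simp add: xor_perm_def)

lemma xor_perm_involution: "xor_perm k (xor_perm k n) = n"
  using half_log_xor_perm[of k n] by (auto simp: xor_perm_def xor.assoc)

lemma infinite_permutation_xor_perm: "infinite_permutation (xor_perm k)"
  unfolding infinite_permutation_def permutes_def
proof (intro conjI allI impI)
  fix n :: nat
  assume "n \<notin> {1..}"
  \<comment> \<open>Here \<open>n = 0\<close> and \<open>half_log 0 = 0\<close>, so the guard admits
    only \<open>k = 0\<close>, whose mask is 0.\<close>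
  then show "xor_perm k n = n"
    by (simp add: xor_perm_def half_log_def not_less_eq_eq)
next
  fix y
  show "\<exists>!n. xor_perm k n = y"
    by (metis xor_perm_involution)
qed

lemma xor_perm_gap:
  assumes "j \<noteq> k" "j < 2 ^ half_log n" "k < 2 ^ half_log n"
  shows "2 ^ half_log n \<le> \<bar>int (xor_perm j n) - int (xor_perm k n)\<bar>"
proof -
  define t where "t = half_log n"
  have x: "xor_perm i n = n XOR push_bit t i" if "i < 2 ^ t" for i
    using that by (simp add: xor_perm_def t_def)
  \<comment> \<open>The mask has its low \<open>t\<close> bits clear, so XOR leaves those of
    \<open>n\<close> untouched.\<close>
  have "take_bit t (xor_perm i n) = take_bit t n" if "i < 2 ^ t" for i
    using that by (simp add: x take_bit_push_bit)
  then have "xor_perm j n mod 2 ^ t = xor_perm k n mod 2 ^ t"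
    using assms by (simp add: take_bit_eq_mod t_def)
  then have "int (xor_perm j n) mod 2 ^ t = int (xor_perm k n) mod 2 ^ t"
    by (metis of_nat_mod of_nat_numeral of_nat_power)
  then have "2 ^ t dvd int (xor_perm j n) - int (xor_perm k n)"
    by (simp add: mod_eq_dvd_iff)
  moreover have "xor_perm j n \<noteq> xor_perm k n"
  proof
    assume "xor_perm j n = xor_perm k n"
    then have "n XOR (n XOR push_bit t j) = n XOR (n XOR push_bit t k)"
      using assms by (simp add: x t_def)
    then show False
      using assms(1) by (simp add: push_bit_eq_mult flip: xor.assoc)
  qed
  ultimately show ?thesis
    using dvd_imp_le_int[of "int (xor_perm j n) - int (xor_perm k n)" "2 ^ t"]
    by (simp add: t_def)
qed

lemma diverge_xor_perm:
  assumes "j \<noteq> k"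
  shows "diverge (xor_perm j) (xor_perm k)"
  unfolding diverge_def filterlim_at_top
proof
  fix Z :: int
  \<comment> \<open>Once \<open>T < 2 ^ half_log n\<close>, both \<open>j\<close> and
    \<open>k\<close> pass the guard and the gap exceeds \<open>Z\<close>.\<close>
  define T where "T = nat Z + j + k"
  show "\<forall>\<^sub>F n in sequentially. Z \<le> \<bar>int (xor_perm j n) - int (xor_perm k n)\<bar>"
    using eventually_ge_at_top[of "2 ^ (2 * T)"]
  proof eventually_elim
    case (elim n)
    then have "2 * T \<le> floor_log n"
      using floor_log_le_iff[of "2 ^ (2 * T)" n] by simp
    then have "T \<le> half_log n"
      by (simp add: half_log_def)
    then have less: "T < 2 ^ half_log n"
      using less_exp[of "half_log n"] by linarith
    then have "int T < 2 ^ half_log n"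
      by (metis of_nat_less_iff of_nat_numeral of_nat_power)
    moreover have "Z \<le> int T"
      by (simp add: T_def)
    moreover have "2 ^ half_log n \<le> \<bar>int (xor_perm j n) - int (xor_perm k n)\<bar>"
      using less by (intro xor_perm_gap assms) (simp_all add: T_def)
    ultimately show ?case
      by linarith
  qed
qed

lemma not_diverge_self: "\<not> diverge x x"
  by (auto simp: diverge_def filterlim_at_top intro!: exI[of _ 1])

theorem theorem1:
  "\<exists>S :: (nat \<Rightarrow> nat) set. infinite S \<and> (\<forall>x\<in>S. infinite_permutation x) \<and> pairwise diverge S"
proof (intro exI conjI)
  \<comment> \<open>If two distinct indices gave the same permutation, it would diverge from
    itself.\<close>
  have "inj xor_perm"
    by (metis injI diverge_xor_perm not_diverge_self)
  then show "infinite (range xor_perm)"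
    by (simp add: finite_image_iff)
  show "\<forall>x\<in>range xor_perm. infinite_permutation x"
    using infinite_permutation_xor_perm by blast
  show "pairwise diverge (range xor_perm)"
    by (auto simp: pairwise_def intro: diverge_xor_perm)
qed

end
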